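(* Let $f,F\in\mathbb{R}[x]$ be two standard polynomials satisfying $$F(x)=u(x)f(x)+v(x)f'(x),$$ where $u(x),v(x)$ are real polynomials and $\deg F=\deg f$ or $\deg F=\deg f+1$. Assume that $f\in\mathrm{RZ}$ and that $v(r)\le 0$ whenever $f(r)=0$. Then $F\in\mathrm{RZ}$ and $f\preceq F$. Moreover, if $r$ is a zero of $f$ with multiplicity $m$, then the multiplicity of $r$ as a zero of $F$ is (a) $m-1$ if $v(r)\neq 0$; (b) $m$ if $v(r)=0$ but $u(r)+mv'(r)\neq 0$; (c) $m+1$ if $v(r)=0$ and $u(r)+mv'(r)=0$. Furthermore: (A) Suppose that $f\in\mathrm{RZ}(-\infty,r]$, where $r$ is the largest zero of $f$, with multiplicity $m$. Then $F\in\mathrm{RZ}(-\infty,r]$ if and only if $v(r)=0$ and $u(r)+mv'(r)\ge 0$. (B) Suppose that $f\in\mathrm{RZ}[r,+\infty)$, where $r$ is the smallest zero of $f$, with multiplicity $m$. Then $F\in\mathrm{RZ}[r,+\infty)$ if and only if either $\deg F=\deg f$, or both $v(r)=0$ and $u(r)+mv'(r)\le 0$.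
   Context: A real polynomial is called standard if it has positive leading coefficient. $\mathrm{RZ}$ denotes the set of real polynomials with only real zeros (nonzero constants belong to it vacuously), and for an interval $I\subseteq\mathbb{R}$, $\mathrm{RZ}\,I$ (e.g. $\mathrm{RZ}(-\infty,r]$, $\mathrm{RZ}[r,+\infty)$) denotes the set of such polynomials all of whose zeros lie in $I$. For $f,F\in\mathrm{RZ}$, let $\{r_i\}$ and $\{s_j\}$ be all zeros of $f$ and $F$ respectively, listed with multiplicity in nonincreasing order. We say that $f$ separates $F$, written $f\preceq F$, if $\deg f\le\deg F\le\deg f+1$ and $s_1\ge r_1\ge s_2\ge r_2\ge s_3\ge r_3\ge\cdots$ (the chain running through all zeros of $f$ and $F$). *)

theory Defs
  imports
    Complex_Main
    "HOL-Library.Multiset"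
    "HOL-Computational_Algebra.Fundamental_Theorem_Algebra"
begin

definition standard_poly :: "real poly \<Rightarrow> bool" where
  "standard_poly p \<longleftrightarrow> lead_coeff p > 0"

text \<open>
  Zeros are taken in the complex plane. The zero polynomial does not belong to
  this set, since then \<open>\<i>\<close> would be a zero; nonzero constants do.
\<close>

definition RZ :: "real poly set" where
  "RZ = {p. \<forall>z::complex. poly (map_poly of_real p) z = 0 \<longrightarrow> z \<in> \<real>}"

definition RZ_on :: "real set \<Rightarrow> real poly set" where
  "RZ_on I = {p \<in> RZ. \<forall>x. poly p x = 0 \<longrightarrow> x \<in> I}"

definition zeros_desc :: "real poly \<Rightarrow> real list" where
  "zeros_desc p = rev (sorted_list_of_multiset (proots p))"

text \<open>
  Lists are indexed from \<open>0\<close>, so the chain reads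
  \<open>s\<^sub>0 \<ge> r\<^sub>0 \<ge> s\<^sub>1 \<ge> r\<^sub>1 \<ge> \<dots>\<close>. As both polynomials are real-rooted, their lists of
  zeros have lengths \<open>degree f\<close> and \<open>degree F\<close>; with the degree condition, every
  index below is in range.
\<close>

definition separates :: "real poly \<Rightarrow> real poly \<Rightarrow> bool"  (infix "\<preceq>" 50) where
  "f \<preceq> F \<longleftrightarrow> f \<in> RZ \<and> F \<in> RZ \<and>
     degree f \<le> degree F \<and> degree F \<le> degree f + 1 \<and>
     (\<forall>i < length (zeros_desc f). zeros_desc F ! i \<ge> zeros_desc f ! i) \<and>
     (\<forall>i. Suc i < length (zeros_desc F) \<longrightarrow> zeros_desc f ! i \<ge> zeros_desc F ! Suc i)"

end

(*
  Write f = d * g, where g is squarefree with the same zeros as f. Then f' = d * h and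
  F = d * G with G = u * g + v * h. At a zero a of g, h(a) is a positive multiple of g'(a),
  so G(a) * g'(a) <= 0. After cancelling common zeros of g and G the inequality is strict.
  The sign of a polynomial with positive leading coefficient at x is (-1)^k, k being the
  number of its zeros above x, so the number of zeros of G above a has the opposite parity
  to that of g. As these counts are monotone in a and bounded by the degree, all zeros of G
  are real and, on every upper set, G has as many zeros as g or one more; multiplying by d
  preserves this. The same parity argument at a zero r of f decides on which side of r the
  extra zero of F lies.
*)
theory Submission
  imports Defs
begin

subsection \<open>Counting zeros\<close>

text \<open>Such counts are additive under multiplication, so interlacing can be proved for
  cofactors and carried over to products. Sorted lists of zeros return only in
  \<open>separatesI\<close>.\<close>

definition num_zeros :: "real poly \<Rightarrow> real set \<Rightarrow> nat" where
  "num_zeros p U = size (filter_mset (\<lambda>x. x \<in> U) (proots p))"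

text \<open>Open rays will yield the chain of zeros, closed rays the bounds on multiplicities, and
  \<open>UNIV\<close> the number of all real zeros.\<close>

definition upper_set :: "real set \<Rightarrow> bool" where
  "upper_set U \<longleftrightarrow> (\<forall>x\<in>U. \<forall>y\<ge>x. y \<in> U)"

lemma upper_setD: "upper_set U \<Longrightarrow> x \<in> U \<Longrightarrow> x \<le> y \<Longrightarrow> y \<in> U"
  by (auto simp: upper_set_def)

lemma upper_set_greaterThan [simp]: "upper_set {x<..}"
  and upper_set_atLeast [simp]: "upper_set {x..}"
  and upper_set_UNIV [simp]: "upper_set UNIV"
  by (auto simp: upper_set_def)

lemma num_zeros_mult:
  "p \<noteq> 0 \<Longrightarrow> q \<noteq> 0 \<Longrightarrow> num_zeros (p * q) U = num_zeros p U + num_zeros q U"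
  by (simp add: num_zeros_def proots_mult)

lemma num_zeros_linear [simp]: "num_zeros [:-a, 1:] U = (if a \<in> U then 1 else 0)"
  by (simp add: num_zeros_def)

lemma num_zeros_linear_power:
  "num_zeros ([:-a, 1:] ^ n) U = (if a \<in> U then n else 0)"
proof (induction n)
  case (Suc n)
  then show ?case
    using num_zeros_mult[of "[:-a, 1:]" "[:-a, 1:] ^ n" U] by (simp del: mult_pCons_left)
qed (simp add: num_zeros_def)

lemma num_zeros_mono: "U \<subseteq> V \<Longrightarrow> num_zeros p U \<le> num_zeros p V"
  unfolding num_zeros_def
  by (intro size_mset_mono filter_mset_mono_strong) auto

lemma num_zeros_eq_0_iff:
  "p \<noteq> 0 \<Longrightarrow> num_zeros p U = 0 \<longleftrightarrow> (\<forall>x\<in>U. poly p x \<noteq> 0)"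
  by (auto simp: num_zeros_def filter_mset_eq_mempty_iff)

lemma num_zeros_UNIV: "num_zeros p UNIV = size (proots p)"
  by (simp add: num_zeros_def)

lemma num_zeros_le_degree: "num_zeros p U \<le> degree p"
  using num_zeros_mono[of U UNIV p] size_proots_le[of p] by (simp add: num_zeros_UNIV)

lemma num_zeros_atLeast:
  assumes "p \<noteq> 0"
  shows "num_zeros p {r..} = num_zeros p {r<..} + order r p"
proof -
  have "filter_mset (\<lambda>x. x \<in> {r..}) (proots p) =
        filter_mset (\<lambda>x. x \<in> {r<..}) (proots p) + replicate_mset (order r p) r"
    using assms by (intro multiset_eqI) auto
  then show ?thesis by (simp add: num_zeros_def)
qed

text \<open>Collects what an induction needs when it removes one real zero.\<close>

lemma root_factorE:
  assumes "p \<noteq> 0" "poly p a = 0"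
  obtains q where "p = [:-a, 1:] * q" "q \<noteq> 0" "degree p = Suc (degree q)"
    "lead_coeff q = lead_coeff p" "\<And>x. poly p x = (x - a) * poly q x"
    "\<And>U. num_zeros p U = (if a \<in> U then 1 else 0) + num_zeros q U"
proof -
  obtain q where q: "p = [:-a, 1:] * q"
    using assms by (metis dvdE poly_eq_0_iff_dvd)
  have q0: "q \<noteq> 0" using assms q by auto
  have "degree p = Suc (degree q)"
    unfolding q using q0 by (subst degree_mult_eq) auto
  moreover have "lead_coeff q = lead_coeff p" unfolding q lead_coeff_mult by simp
  moreover have "poly p x = (x - a) * poly q x" for x by (simp add: q algebra_simps)
  moreover have "num_zeros p U = (if a \<in> U then 1 else 0) + num_zeros q U" for U
    unfolding q using q0 by (subst num_zeros_mult) auto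
  ultimately show ?thesis using q q0 that by blast
qed

text \<open>Each zero \<open>a\<close> above \<open>x\<close> contributes a negative factor
  \<open>x - a\<close> and is split off. Once no zero is left above \<open>x\<close>, the
  intermediate value theorem forbids a sign change there, and far to the right the leading
  coefficient makes the value positive.\<close>

lemma sgn_poly_eq_num_zeros:
  assumes "lead_coeff p > 0" "poly p x \<noteq> 0"
  shows "sgn (poly p x) = (-1) ^ num_zeros p {x<..}"
  using assms
proof (induction "degree p" arbitrary: p rule: less_induct)
  case less
  then have p0: "p \<noteq> 0" by auto
  show ?case
  proof (cases "\<exists>a>x. poly p a = 0")
    case True
    then obtain a where a: "a > x" "poly p a = 0" by auto
    obtain q where q: "degree p = Suc (degree q)" "lead_coeff q = lead_coeff p"
        "\<And>x. poly p x = (x - a) * poly q x"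
        "\<And>U. num_zeros p U = (if a \<in> U then 1 else 0) + num_zeros q U"
      using root_factorE[OF p0 a(2)] by metis
    have "sgn (poly q x) = (-1) ^ num_zeros q {x<..}"
      using less.hyps[of q] less.prems q by auto
    then show ?thesis
      using a by (simp add: q sgn_mult)
  next
    case False
    then have nz: "num_zeros p {x<..} = 0" using p0 by (auto simp: num_zeros_eq_0_iff)
    obtain n where n: "\<And>y. y \<ge> n \<Longrightarrow> poly p y \<ge> lead_coeff p"
      using poly_pinfty_gt_lc[OF less.prems(1)] by auto
    have "poly p x > 0"
    proof (rule ccontr)
      assume "\<not> poly p x > 0"
      then have "poly p x < 0" using less.prems by auto
      \<comment> \<open>The maximum is strictly to the right of \<open>x\<close> and not below
        \<open>n\<close>, from where on \<open>p\<close> is at least its leading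
        coefficient.\<close>
      moreover have "poly p (max n (x + 1)) > 0" using n[of "max n (x+1)"] less.prems by auto
      ultimately obtain y where "x < y" "poly p y = 0"
        using poly_IVT_pos[of x "max n (x+1)" p] by (auto simp: less_max_iff_disj)
      then show False using False by auto
    qed
    then show ?thesis by (simp add: nz)
  qed
qed

subsection \<open>Interlacing from alternating signs\<close>

text \<open>Induction step of \<open>parity_lower_bound\<close>: \<open>b\<close> is the next
  element of \<open>S\<close> to the right of \<open>a\<close>, so only \<open>b\<close> itself is
  lost in passing from \<open>a\<close> to \<open>b\<close>.\<close>

lemma card_greater_Min:
  fixes S :: "real set"
  assumes "finite S" "{b\<in>S. a < b} \<noteq> {}"
  defines "b \<equiv> Min {b\<in>S. a < b}"
  shows "b \<in> S" "a < b" "card {c\<in>S. a < c} = Suc (card {c\<in>S. b < c})"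
proof -
  have "b \<in> {b\<in>S. a < b}" unfolding b_def using assms by (intro Min_in) auto
  then show b: "b \<in> S" "a < b" by auto
  have "b \<le> c" if "c \<in> S" "a < c" for c
    unfolding b_def using assms that by (intro Min_le) auto
  then have "{c\<in>S. a < c} = insert b {c\<in>S. b < c}" using b by force
  then show "card {c\<in>S. a < c} = Suc (card {c\<in>S. b < c})" using assms(1) by simp
qed

text \<open>The leftward counterpart, for \<open>parity_upper_bound\<close>. The element gained is
  now \<open>a\<close> itself, hence the hypothesis \<open>a \<in> S\<close>.\<close>

lemma card_greater_Max:
  fixes S :: "real set"
  assumes "finite S" "a \<in> S" "{b\<in>S. b < a} \<noteq> {}"
  defines "b \<equiv> Max {b\<in>S. b < a}"
  shows "b \<in> S" "b < a" "card {c\<in>S. b < c} = Suc (card {c\<in>S. a < c})"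
proof -
  have "b \<in> {b\<in>S. b < a}" unfolding b_def using assms by (intro Max_in) auto
  then show b: "b \<in> S" "b < a" by auto
  have "c \<le> b" if "c \<in> S" "c < a" for c
    unfolding b_def using assms that by (intro Max_ge) auto
  then have "{c\<in>S. b < c} = insert a {c\<in>S. a < c}" using b assms by force
  then show "card {c\<in>S. b < c} = Suc (card {c\<in>S. a < c})" using assms(1) by simp
qed

text \<open>Here \<open>c a\<close> stands for the number of zeros of \<open>G\<close> above
  \<open>a\<close>. The induction runs leftwards from the largest element, where an odd count is at
  least 1. The bound inherited from the right neighbour is short by one, and parity supplies the
  missing one.\<close>

lemma parity_lower_bound:
  fixes S :: "real set" and c :: "real \<Rightarrow> nat"
  assumes "finite S" "antimono c" "\<And>a. a \<in> S \<Longrightarrow> odd (c a + card {b\<in>S. a < b})" "a \<in> S"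
  shows "card {b\<in>S. a < b} + 1 \<le> c a"
  using assms(4)
proof (induction "card {b\<in>S. a < b}" arbitrary: a rule: less_induct)
  case less
  show ?case
  proof (cases "{b\<in>S. a < b} = {}")
    case True
    have "odd (c a)" using assms(3)[OF less.prems] by (simp only: True) simp
    then show ?thesis unfolding True by (auto elim: oddE)
  next
    case False
    obtain b where b: "b \<in> S" "a < b" "card {c\<in>S. a < c} = Suc (card {c\<in>S. b < c})"
      using card_greater_Min[OF assms(1) False] by blast
    have "card {c\<in>S. b < c} + 1 \<le> c b" using less.hyps[of b] b by simp
    moreover have "c b \<le> c a" using b antimonoD[OF assms(2)] by simp
    moreover have "c a \<noteq> card {c\<in>S. a < c}" using assms(3)[OF less.prems] by auto
    ultimately show ?thesis using b by simp
  qed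
qed

text \<open>The induction runs rightwards from the smallest element, where the global bound
  \<open>card S + 1\<close> gets it started. Each estimate is too large by one, and parity
  (\<open>ne\<close>) excludes the extremal value.\<close>

lemma parity_upper_bound:
  fixes S :: "real set" and c :: "real \<Rightarrow> nat"
  assumes "finite S" "antimono c" "\<And>a. a \<in> S \<Longrightarrow> odd (c a + card {b\<in>S. a < b})" "a \<in> S"
    and "\<And>a. c a \<le> card S + 1"
  shows "c a \<le> card {b\<in>S. a < b} + 1"
  using assms(4)
proof (induction "card {b\<in>S. b < a}" arbitrary: a rule: less_induct)
  case less
  have ne: "c a \<noteq> card {c\<in>S. a < c} + 2" using assms(3)[OF less.prems] by auto
  show ?case
  proof (cases "{b\<in>S. b < a} = {}")
    case True
    then have "S = insert a {b\<in>S. a < b}" using less.prems by force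
    then have "card S = card (insert a {b\<in>S. a < b})" by (rule arg_cong)
    then have "card S = Suc (card {b\<in>S. a < b})" using assms(1) by simp
    then show ?thesis using assms(5)[of a] ne by simp
  next
    case False
    obtain b where b: "b \<in> S" "b < a" "card {c\<in>S. b < c} = Suc (card {c\<in>S. a < c})"
      using card_greater_Max[OF assms(1) less.prems False] by blast
    have "card {c\<in>S. c < b} < card {c\<in>S. c < a}"
      using assms(1) b by (intro psubset_card_mono) auto
    then have "c b \<le> card {c\<in>S. b < c} + 1" using less.hyps[of b] b by simp
    moreover have "c a \<le> c b" using b antimonoD[OF assms(2)] by simp
    ultimately show ?thesis using b ne by simp
  qed
qed

text \<open>Removing real zeros preserves the gap between degree and count. What remains has no real
  zero and degree at most 1, and degree 1 would force a real zero.\<close>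

lemma num_zeros_UNIV_eq_degree:
  assumes "p \<noteq> 0" "degree p \<le> num_zeros p UNIV + 1"
  shows "num_zeros p UNIV = degree p"
  using assms
proof (induction "degree p" arbitrary: p rule: less_induct)
  case less
  show ?case
  proof (cases "\<exists>a. poly p a = 0")
    case True
    then obtain a where a: "poly p a = 0" by auto
    obtain q where q: "q \<noteq> 0" "degree p = Suc (degree q)"
        "\<And>U. num_zeros p U = (if a \<in> U then 1 else 0) + num_zeros q U"
      using root_factorE[OF less.prems(1) a] by metis
    then show ?thesis using less.hyps[of q] less.prems q by auto
  next
    case False
    then have "num_zeros p UNIV = 0" using less.prems by (simp add: num_zeros_eq_0_iff)
    moreover have "degree p \<noteq> 1"
    proof
      assume 1: "degree p = 1"
      then obtain a b where "p = [:a, b:]" "b \<noteq> 0"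
        by (metis degree1_coeffs)
      then have "poly p (-a/b) = 0" by simp
      then show False using False by blast
    qed
    ultimately show ?thesis using less.prems by simp
  qed
qed

text \<open>For \<open>a \<in> S\<close> the product is the derivative at \<open>a\<close> of the
  monic polynomial with simple zeros \<open>S\<close>.\<close>

lemma sgn_prod_diff:
  fixes S :: "real set"
  assumes "finite S"
  shows "sgn (\<Prod>b\<in>S - {a}. a - b) = (-1) ^ card {b\<in>S. a < b}"
proof -
  have "sgn (\<Prod>b\<in>S - {a}. a - b) = (\<Prod>b\<in>S - {a}. if a < b then -1 else 1)"
    using assms by (induction S rule: finite_induct) (auto simp: sgn_mult insert_Diff_if)
  also have "\<dots> = (\<Prod>b\<in>{b\<in>S. a < b}. -1)"
    using assms by (intro prod.mono_neutral_cong_right) auto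
  finally show ?thesis by simp
qed

text \<open>Comparing the sign formulas for \<open>poly G a\<close> and for the product gives the
  parity that both parity bounds require. These bounds concern rays at points of \<open>S\<close>;
  the rest transfers them to arbitrary upper sets.\<close>

lemma interlacing_of_strict_signs:
  fixes S :: "real set" and G :: "real poly"
  assumes S: "finite S" and G: "lead_coeff G > 0" and deg: "degree G = card S \<or> degree G = card S + 1"
    and sign: "\<And>a. a \<in> S \<Longrightarrow> poly G a * (\<Prod>b\<in>S - {a}. a - b) < 0"
    and U: "upper_set U"
  shows "num_zeros G UNIV = degree G \<and>
    card (S \<inter> U) \<le> num_zeros G U \<and> num_zeros G U \<le> card (S \<inter> U) + 1"
proof -
  define c where "c = (\<lambda>x. num_zeros G {x<..})"
  have c: "antimono c" unfolding c_def by (intro antimonoI num_zeros_mono) auto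
  have par: "odd (c a + card {b\<in>S. a < b})" if "a \<in> S" for a
  proof -
    have "poly G a \<noteq> 0" using sign[OF that] by auto
    then have "sgn (poly G a * (\<Prod>b\<in>S - {a}. a - b)) = (-1) ^ (c a + card {b\<in>S. a < b})"
      using sgn_poly_eq_num_zeros[OF G, of a] sgn_prod_diff[OF S, of a]
      by (simp add: sgn_mult c_def power_add)
    moreover have "sgn (poly G a * (\<Prod>b\<in>S - {a}. a - b)) = -1"
      using sign[OF that] by (rule sgn_neg)
    ultimately show ?thesis
      by (cases "even (c a + card {b\<in>S. a < b})") (metis one_neq_neg_one neg_one_even_power, assumption)
  qed
  have c_le: "c a \<le> card S + 1" for a
    using num_zeros_le_degree[of G "{a<..}"] deg by (auto simp: c_def)
  note lower = parity_lower_bound[OF S c par]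
  note upper = parity_upper_bound[OF S c par _ c_le]
  have low: "card (S \<inter> V) \<le> num_zeros G V" if V: "upper_set V" for V
  proof (cases "S \<inter> V = {}")
    case False
    \<comment> \<open>The ray above the least element of \<open>S \<inter> V\<close> lies in
      \<open>V\<close> and misses only that element of \<open>S \<inter> V\<close>, for which the
      \<open>+ 1\<close> in \<open>lower\<close> compensates.\<close>
    define a where "a = Min (S \<inter> V)"
    have a: "a \<in> S \<inter> V" unfolding a_def using False S by (intro Min_in) auto
    have "a \<le> b" if "b \<in> S \<inter> V" for b unfolding a_def using that S by (intro Min_le) auto
    then have "S \<inter> V \<subseteq> insert a {b\<in>S. a < b}" by (auto simp: order.strict_iff_order)
    then have "card (S \<inter> V) \<le> card (insert a {b\<in>S. a < b})" using S by (intro card_mono) auto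
    also have "\<dots> = card {b\<in>S. a < b} + 1" using S by simp
    also have "\<dots> \<le> c a" using lower a by simp
    also have "\<dots> \<le> num_zeros G V"
      unfolding c_def using a upper_setD[OF V, of a] by (intro num_zeros_mono) auto
    finally show ?thesis .
  qed simp
  have "num_zeros G U \<le> card (S \<inter> U) + 1"
  proof (cases "S \<subseteq> U")
    case True
    then show ?thesis using num_zeros_le_degree[of G U] deg by (auto simp: Int_absorb2)
  next
    case False
    \<comment> \<open>\<open>U\<close> lies to the right of the greatest element of \<open>S\<close>
      outside it, and contains every element of \<open>S\<close> above that one.\<close>
    define a where "a = Max (S - U)"
    have a: "a \<in> S - U" unfolding a_def using False S by (intro Max_in) auto
    have "b \<le> a" if "b \<in> S - U" for b unfolding a_def using that S by (intro Max_ge) auto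
    then have sub: "{b\<in>S. a < b} \<subseteq> S \<inter> U" by (auto simp flip: not_le)
    have "U \<subseteq> {a<..}" using upper_setD[OF U, of _ a] a by (auto simp flip: not_le)
    then have "num_zeros G U \<le> c a" unfolding c_def by (rule num_zeros_mono)
    also have "\<dots> \<le> card {b\<in>S. a < b} + 1" using upper a by simp
    also have "\<dots> \<le> card (S \<inter> U) + 1" using S sub by (simp add: card_mono)
    finally show ?thesis .
  qed
  \<comment> \<open>On \<open>UNIV\<close> the lower bound gives \<open>card S\<close> real zeros,
    so at most one is missing.\<close>
  moreover have "num_zeros G UNIV = degree G"
    using low[of UNIV] deg G by (intro num_zeros_UNIV_eq_degree) auto
  ultimately show ?thesis using low[OF U] by blast
qed

text \<open>A common zero \<open>a\<close> is removed from both \<open>S\<close> and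
  \<open>G\<close>. At each other \<open>b\<close> this divides the sign expression by the positive
  square of \<open>b - a\<close>, and all counts drop alike. When no common zero is left, the
  inequalities are strict.\<close>

lemma interlacing_of_signs:
  fixes S :: "real set" and G :: "real poly"
  assumes "finite S" "lead_coeff G > 0" "degree G = card S \<or> degree G = card S + 1"
    and "\<And>a. a \<in> S \<Longrightarrow> poly G a * (\<Prod>b\<in>S - {a}. a - b) \<le> 0"
    and U: "upper_set U"
  shows "num_zeros G UNIV = degree G \<and>
    card (S \<inter> U) \<le> num_zeros G U \<and> num_zeros G U \<le> card (S \<inter> U) + 1"
  using assms(1-4)
proof (induction "card S" arbitrary: S G rule: less_induct)
  case less
  show ?case
  proof (cases "\<exists>a\<in>S. poly G a = 0")
    case True
    then obtain a where a: "a \<in> S" "poly G a = 0" by auto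
    have "G \<noteq> 0" using less.prems(2) by auto
    obtain q where dq: "degree G = Suc (degree q)" and lq: "lead_coeff q = lead_coeff G"
      and q: "\<And>x. poly G x = (x - a) * poly q x"
      and nz: "\<And>U. num_zeros G U = (if a \<in> U then 1 else 0) + num_zeros q U"
      by (rule root_factorE[OF \<open>G \<noteq> 0\<close> a(2)], rule that)
    have cS: "card S = Suc (card (S - {a}))" using less.prems(1) a(1) by (rule card.remove)
    have sign: "poly q b * (\<Prod>c\<in>S - {a} - {b}. b - c) \<le> 0" if b: "b \<in> S - {a}" for b
    proof -
      define P where "P = (\<Prod>c\<in>S - {a} - {b}. b - c)"
      have eq: "S - {b} - {a} = S - {a} - {b}" by auto
      have "(\<Prod>c\<in>S - {b}. b - c) = (b - a) * P"
        unfolding P_def eq[symmetric] using b a less.prems(1) by (intro prod.remove) auto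
      then have "(b - a) * poly q b * ((b - a) * P) \<le> 0"
        using less.prems(4)[of b] b unfolding q by simp
      then have "(b - a)\<^sup>2 * (poly q b * P) \<le> 0" by (simp only: power2_eq_square mult_ac)
      moreover have "(b - a)\<^sup>2 > 0" using b by simp
      ultimately have "poly q b * P \<le> 0" by (simp add: mult_le_0_iff)
      then show ?thesis unfolding P_def .
    qed
    have IH: "num_zeros q UNIV = degree q \<and>
        card ((S - {a}) \<inter> U) \<le> num_zeros q U \<and> num_zeros q U \<le> card ((S - {a}) \<inter> U) + 1"
    proof (rule less.hyps)
      show "card (S - {a}) < card S" "finite (S - {a})" "lead_coeff q > 0"
        using cS lq less.prems(1,2) by simp_all
      show "degree q = card (S - {a}) \<or> degree q = card (S - {a}) + 1"
        using cS dq less.prems(3) by simp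
    qed (rule sign)
    have "card (S \<inter> U) = (if a \<in> U then 1 else 0) + card ((S - {a}) \<inter> U)"
    proof (cases "a \<in> U")
      case True
      then have "S \<inter> U = insert a ((S - {a}) \<inter> U)" using a by auto
      then have "card (S \<inter> U) = card (insert a ((S - {a}) \<inter> U))" by (rule arg_cong)
      then show ?thesis using True less.prems(1) by simp
    next
      case False
      then have "S \<inter> U = (S - {a}) \<inter> U" by auto
      then show ?thesis using False by simp
    qed
    then show ?thesis using IH nz[of U] nz[of UNIV] dq by simp
  next
    case False
    have "poly G a * (\<Prod>b\<in>S - {a}. a - b) < 0" if "a \<in> S" for a
    proof -
      have "(\<Prod>b\<in>S - {a}. a - b) \<noteq> 0" using less.prems(1) by auto
      then show ?thesis using less.prems(4)[OF that] False that by (auto simp: less_le)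
    qed
    then show ?thesis using interlacing_of_strict_signs[OF less.prems(1-3) _ U] by blast
  qed
qed

subsection \<open>Real-rooted polynomials and their sorted zeros\<close>

text \<open>The product over \<open>A\<close> does not vanish at a new point \<open>x\<close>, so
  the whole order of \<open>p\<close> at \<open>x\<close> sits in the cofactor.\<close>

lemma root_powers_prod_dvd:
  fixes p :: "real poly"
  assumes "p \<noteq> 0" "finite A"
  shows "\<exists>q. p = (\<Prod>a\<in>A. [:-a, 1:] ^ order a p) * q"
  using assms(2)
proof (induction A rule: finite_induct)
  case (insert x A)
  define P where "P = (\<Prod>a\<in>A. [:-a, 1:] ^ order a p)"
  obtain q where q: "p = P * q" using insert.IH by (auto simp: P_def)
  have "poly P x \<noteq> 0" using insert.hyps by (auto simp: P_def poly_prod)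
  then have "order x p = order x q"
    using order_mult[of P q x] assms(1) order_0I[of P x] unfolding q[symmetric] by simp
  then have "[:-x, 1:] ^ order x p dvd q" by (simp add: order_1)
  then obtain r where "q = [:-x, 1:] ^ order x p * r" ..
  then have "p = ([:-x, 1:] ^ order x p * P) * r" using q by (simp only: mult_ac)
  also have "[:-x, 1:] ^ order x p * P = (\<Prod>a\<in>insert x A. [:-a, 1:] ^ order a p)"
    unfolding P_def using insert.hyps by (rule prod.insert[symmetric])
  finally show ?case ..
qed auto

text \<open>The product already has degree equal to the sum of all orders, that is
  \<open>degree p\<close>, so the cofactor is constant.\<close>

lemma real_rooted_factorization:
  assumes "p \<noteq> 0" "num_zeros p UNIV = degree p"
  shows "p = smult (lead_coeff p) (\<Prod>a | poly p a = 0. [:-a, 1:] ^ order a p)"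
proof -
  define P where "P = (\<Prod>a | poly p a = 0. [:-a, 1:] ^ order a p)"
  have P: "lead_coeff P = 1" unfolding P_def lead_coeff_prod by (simp add: lead_coeff_power)
  have "finite {a. poly p a = 0}" using assms(1) by (rule poly_roots_finite)
  then obtain q where q: "p = P * q" using root_powers_prod_dvd[OF assms(1)] P_def by metis
  have "degree P = (\<Sum>a | poly p a = 0. degree ([:-a, 1:] ^ order a p))"
    unfolding P_def by (intro degree_prod_eq_sum_degree) auto
  also have "\<dots> = (\<Sum>a | poly p a = 0. order a p)"
    by (simp add: degree_power_eq)
  also have "\<dots> = degree p"
    using assms by (simp add: num_zeros_UNIV size_multiset_overloaded_eq)
  finally have "degree P = degree p" .
  moreover have "degree p = degree P + degree q"
    using assms(1) q by (metis degree_mult_eq mult_zero_left mult_zero_right)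
  ultimately have "degree q = 0" by simp
  then obtain c where c: "q = [:c:]" by (rule degree_eq_zeroE)
  have "p = smult c P" using q c by simp
  moreover from this have "lead_coeff p = c" using P by (metis lead_coeff_smult mult.right_neutral)
  ultimately show ?thesis unfolding P_def by simp
qed

lemma poly_of_real_mult:
  "poly (map_poly of_real (p * q)) z =
     poly (map_poly of_real p) z * (poly (map_poly of_real q) z :: complex)"
proof -
  have add: "poly (map_poly of_real (p + q)) z =
      poly (map_poly of_real p) z + (poly (map_poly of_real q) z :: complex)" for p q
    by (induction p q rule: poly_induct2) (auto simp: map_poly_pCons algebra_simps)
  have smult: "poly (map_poly of_real (smult c q)) z =
      of_real c * (poly (map_poly of_real q) z :: complex)" for c
    by (induction q) (auto simp: map_poly_pCons algebra_simps)
  show ?thesis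
    by (induction p) (auto simp: map_poly_pCons add smult algebra_simps)
qed

lemma poly_of_real_of_real:
  "poly (map_poly of_real p) (of_real x) = (of_real (poly p x) :: complex)"
  by (induction p) (auto simp: map_poly_pCons)

text \<open>Links the definition by complex zeros to real counts. After all real zeros are split
  off, the quotient is constant or, by the fundamental theorem of algebra, has a zero, which cannot
  be real.\<close>

lemma RZ_iff_num_zeros:
  assumes "p \<noteq> 0"
  shows "p \<in> RZ \<longleftrightarrow> num_zeros p UNIV = degree p"
  using assms
proof (induction "degree p" arbitrary: p rule: less_induct)
  case less
  show ?case
  proof (cases "\<exists>a. poly p a = 0")
    case True
    then obtain a where a: "poly p a = 0" by auto
    obtain q where q: "p = [:-a, 1:] * q" "q \<noteq> 0" "degree p = Suc (degree q)"
        "\<And>U. num_zeros p U = (if a \<in> U then 1 else 0) + num_zeros q U"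
      using root_factorE[OF less.prems a] by metis
    have "poly (map_poly of_real p) z = (z - of_real a) * (poly (map_poly of_real q) z :: complex)" for z
      unfolding q(1) poly_of_real_mult by (simp add: map_poly_pCons)
    then have "p \<in> RZ \<longleftrightarrow> q \<in> RZ" unfolding RZ_def by auto
    then show ?thesis using less.hyps[of q] q by simp
  next
    case False
    then have nz: "num_zeros p UNIV = 0" using less.prems by (simp add: num_zeros_eq_0_iff)
    show ?thesis
    proof (cases "degree p = 0")
      case True
      then obtain c where "p = [:c:]" by (rule degree_eq_zeroE)
      then show ?thesis using less.prems nz by (auto simp: RZ_def map_poly_pCons)
    next
      case deg: False
      have "degree (map_poly of_real p :: complex poly) = degree p"
        by (intro degree_map_poly) auto
      then obtain z :: complex where z: "poly (map_poly of_real p) z = 0"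
        using alg_closed_imp_poly_has_root[of "map_poly of_real p :: complex poly"] deg by auto
      have "z \<notin> \<real>"
      proof
        assume "z \<in> \<real>"
        then obtain x where "z = of_real x" by (auto elim: Reals_cases)
        then show False using z False by (simp add: poly_of_real_of_real)
      qed
      then show ?thesis using z nz deg by (auto simp: RZ_def)
    qed
  qed
qed

section \<open>Sorted zeros and counts above a threshold\<close>

lemma nth_greater_iff:
  fixes xs :: "'a::linorder list"
  assumes "sorted_wrt (\<ge>) xs" "i < length xs"
  shows "x < xs ! i \<longleftrightarrow> i < length (filter (\<lambda>y. x < y) xs)"
  using assms
proof (induction xs arbitrary: i)
  case (Cons y ys)
  show ?case
  proof (cases "x < y")
    case True
    then show ?thesis using Cons by (cases i) auto
  next
    case False
    then have "\<not> x < z" if "z \<in> set (y # ys)" for z using Cons.prems(1) that by auto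
    then have "filter (\<lambda>y. x < y) (y # ys) = []" "\<not> x < (y # ys) ! i"
      using nth_mem[OF Cons.prems(2)] unfolding filter_empty_conv by blast+
    then show ?thesis by (simp only: list.size) simp
  qed
qed simp

text \<open>The entries above \<open>x\<close> form an initial segment of the nonincreasing
  list.\<close>

lemma zeros_desc_nth_greater_iff:
  assumes "i < length (zeros_desc p)"
  shows "x < zeros_desc p ! i \<longleftrightarrow> i < num_zeros p {x<..}"
proof -
  have "num_zeros p {x<..} = size (filter_mset (\<lambda>y. x < y) (mset (zeros_desc p)))"
    by (simp add: num_zeros_def zeros_desc_def)
  also have "\<dots> = length (filter (\<lambda>y. x < y) (zeros_desc p))"
    by (simp flip: mset_filter)
  finally show ?thesis
    using nth_greater_iff[of "zeros_desc p" i x] assms by (simp add: zeros_desc_def sorted_wrt_rev)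
qed

lemma length_zeros_desc: "length (zeros_desc p) = num_zeros p UNIV"
proof -
  have "length (zeros_desc p) = size (mset (zeros_desc p))" by simp
  then show ?thesis by (simp add: zeros_desc_def num_zeros_def del: size_mset)
qed

text \<open>A violated inequality of the chain is refuted by taking its smaller side as the
  threshold \<open>x\<close>: the bounds on the counts would then make that zero greater than
  itself.\<close>

lemma separatesI:
  assumes "f \<in> RZ" "F \<in> RZ" "f \<noteq> 0" "F \<noteq> 0" "degree f \<le> degree F" "degree F \<le> degree f + 1"
    and "\<And>x. num_zeros f {x<..} \<le> num_zeros F {x<..}"
    and "\<And>x. num_zeros F {x<..} \<le> num_zeros f {x<..} + 1"
  shows "f \<preceq> F"
proof -
  have len: "length (zeros_desc f) = degree f" "length (zeros_desc F) = degree F"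
    using assms by (simp_all add: length_zeros_desc RZ_iff_num_zeros)
  have "zeros_desc F ! i \<ge> zeros_desc f ! i" if "i < length (zeros_desc f)" for i
    using zeros_desc_nth_greater_iff[OF that, of "zeros_desc F ! i"]
      zeros_desc_nth_greater_iff[of i F "zeros_desc F ! i"] that len assms(5)
      assms(7)[of "zeros_desc F ! i"]
    by (simp flip: not_less)
  moreover have "zeros_desc f ! i \<ge> zeros_desc F ! Suc i" if "Suc i < length (zeros_desc F)" for i
    using zeros_desc_nth_greater_iff[OF that, of "zeros_desc f ! i"]
      zeros_desc_nth_greater_iff[of i f "zeros_desc f ! i"] that len assms(6)
      assms(8)[of "zeros_desc f ! i"]
    by (simp flip: not_less)
  ultimately show ?thesis using assms unfolding separates_def by blast
qed

subsection \<open>Combinations of a polynomial and its derivative\<close>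

text \<open>Reduces to \<open>interlacing_of_signs\<close> for the cofactor \<open>G\<close>, since
  \<open>d\<close> contributes equally to the counts of \<open>f\<close> and
  \<open>F\<close>.\<close>

lemma interlacing_of_combination:
  fixes f F u v :: "real poly"
  assumes f: "lead_coeff f > 0" and F: "lead_coeff F > 0"
    and eq: "F = u * f + v * pderiv f"
    and deg: "degree F = degree f \<or> degree F = degree f + 1"
    and rr: "num_zeros f UNIV = degree f"
    and v: "\<And>r. poly f r = 0 \<Longrightarrow> poly v r \<le> 0"
  shows "num_zeros F UNIV = degree F"
    and "upper_set U \<Longrightarrow> num_zeros f U \<le> num_zeros F U"
    and "upper_set U \<Longrightarrow> num_zeros F U \<le> num_zeros f U + 1"
proof -
  define S where "S = {a. poly f a = 0}"
  define m where "m = (\<lambda>a. order a f)"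
  define L :: "real \<Rightarrow> real poly" where "L = (\<lambda>a. [:-a, 1:])"
  define c where "c = lead_coeff f"
  \<comment> \<open>One copy of every zero is left out, so that the cofactor of \<open>d\<close> in
    \<open>f\<close> is squarefree.\<close>
  define d where "d = (\<Prod>a\<in>S. L a ^ (m a - 1))"
  \<comment> \<open>This is \<open>pderiv f\<close> divided by \<open>d\<close>: differentiating a
    power of \<open>L a\<close> lowers its exponent to the one in \<open>d\<close> and brings out
    the factor \<open>m a\<close>.\<close>
  define h where "h = smult c (\<Sum>a\<in>S. smult (m a) (\<Prod>b\<in>S - {a}. L b))"
  define G where "G = u * smult c (\<Prod>a\<in>S. L a) + v * h"
  have f0: "f \<noteq> 0" using f by auto
  have S: "finite S" unfolding S_def using f0 by (rule poly_roots_finite)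
  have m: "m a = Suc (m a - 1)" if "a \<in> S" for a
    using that f0 by (auto simp: S_def m_def order_root)
  have L: "pderiv (L a) = 1" "L a \<noteq> 0" "poly (L a) x = x - a" for a x
    by (simp_all add: L_def pderiv_pCons one_pCons)
  have f_prod: "f = smult c (\<Prod>a\<in>S. L a ^ m a)"
    using real_rooted_factorization[OF f0 rr] by (simp add: S_def L_def c_def m_def)
  have split: "(\<Prod>a\<in>A. L a ^ m a) = (\<Prod>a\<in>A. L a ^ (m a - 1)) * (\<Prod>a\<in>A. L a)"
    if "A \<subseteq> S" for A
    unfolding prod.distrib[symmetric] using that m
    by (intro prod.cong refl) (metis power_Suc2 subsetD)
  have f_d: "f = d * smult c (\<Prod>a\<in>S. L a)"
    using f_prod split[of S] by (simp add: d_def)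
  have "pderiv (\<Prod>a\<in>S. L a ^ m a) =
      (\<Sum>a\<in>S. (\<Prod>b\<in>S - {a}. L b ^ m b) * pderiv (L a ^ m a))"
    by (rule pderiv_prod)
  also have "\<dots> = (\<Sum>a\<in>S. d * smult (m a) (\<Prod>b\<in>S - {a}. L b))"
  proof (rule sum.cong)
    fix a assume a: "a \<in> S"
    have "pderiv (L a ^ m a) = smult (m a) (L a ^ (m a - 1))"
      using pderiv_power_Suc[of "L a" "m a - 1", folded m[OF a]] L by simp
    moreover have "d = L a ^ (m a - 1) * (\<Prod>b\<in>S - {a}. L b ^ (m b - 1))"
      unfolding d_def using S a by (rule prod.remove)
    ultimately show "(\<Prod>b\<in>S - {a}. L b ^ m b) * pderiv (L a ^ m a) =
        d * smult (m a) (\<Prod>b\<in>S - {a}. L b)"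
      using split[of "S - {a}"] by (simp add: mult_ac)
  qed simp
  finally have "pderiv f = d * h"
    using f_prod by (simp add: pderiv_smult h_def sum_distrib_left)
  then have F_d: "F = d * G"
    using eq f_d by (simp add: G_def algebra_simps)
  have nz: "d \<noteq> 0" "G \<noteq> 0" using F F_d by auto
  have d: "lead_coeff d = 1" unfolding d_def lead_coeff_prod L_def by (simp add: lead_coeff_power)
  have c: "c > 0" using f by (simp add: c_def)
  have prodL: "(\<Prod>a\<in>S. L a) \<noteq> 0" using S L by simp
  have deg_prodL: "degree (\<Prod>a\<in>S. L a) = card S"
    using L by (subst degree_prod_eq_sum_degree) (auto simp: L_def)
  have num_prodL: "num_zeros (\<Prod>a\<in>S. L a) U = card (S \<inter> U)" for U
    using S
  proof (induction S rule: finite_induct)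
    case (insert x S)
    have "(\<Prod>a\<in>S. L a) \<noteq> 0" using insert L by simp
    then have "num_zeros (\<Prod>a\<in>insert x S. L a) U = (if x \<in> U then 1 else 0) + card (S \<inter> U)"
      using insert L by (simp add: num_zeros_mult L_def del: mult_pCons_left)
    then show ?case using insert by (simp add: Int_insert_left)
  qed (simp add: num_zeros_def)
  have num_f: "num_zeros f U = num_zeros d U + card (S \<inter> U)" for U
    using num_zeros_mult[of d "smult c (\<Prod>a\<in>S. L a)" U] f_d nz prodL c num_prodL
    by (simp add: num_zeros_def)
  have num_F: "num_zeros F U = num_zeros d U + num_zeros G U" for U
    using num_zeros_mult[OF nz] F_d by simp
  have deg_f: "degree f = degree d + card S"
    using f_d nz prodL c deg_prodL by (simp add: degree_mult_eq)
  have deg_F: "degree F = degree d + degree G"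
    using F_d nz by (simp add: degree_mult_eq)
  have num_d: "num_zeros d UNIV = degree d" using num_f[of UNIV] deg_f rr by simp
  have G: "lead_coeff G > 0" using F d unfolding F_d lead_coeff_mult by simp
  have sign: "poly G a * (\<Prod>b\<in>S - {a}. a - b) \<le> 0" if a: "a \<in> S" for a
  proof -
    define P where "P = (\<Prod>b\<in>S - {a}. a - b)"
    have "poly h a = c * (\<Sum>x\<in>S. m x * (\<Prod>b\<in>S - {x}. a - b))"
      by (simp add: h_def poly_sum poly_prod L)
    \<comment> \<open>For \<open>x \<noteq> a\<close> the product contains the factor
      \<open>a - a\<close>.\<close>
    also have "(\<Sum>x\<in>S. m x * (\<Prod>b\<in>S - {x}. a - b)) = (\<Sum>x\<in>{a}. m x * (\<Prod>b\<in>S - {x}. a - b))"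
      using S a by (intro sum.mono_neutral_right) auto
    finally have "poly h a = c * m a * P" by (simp add: P_def)
    moreover have "poly (\<Prod>a\<in>S. L a) a = 0" using S a by (auto simp: poly_prod L)
    \<comment> \<open>The value of \<open>h\<close> at \<open>a\<close> is a positive multiple of
      \<open>P\<close>, so \<open>P\<close> enters squared and only the sign of \<open>v\<close>
      matters.\<close>
    ultimately have "poly G a * P = poly v a * (c * m a * P\<^sup>2)"
      by (simp add: G_def power2_eq_square)
    moreover have "poly v a \<le> 0" using v a by (simp add: S_def)
    ultimately show ?thesis using c unfolding P_def[symmetric]
      by (simp add: mult_nonpos_nonneg)
  qed
  have degG: "degree G = card S \<or> degree G = card S + 1"
    using deg deg_f deg_F by simp
  have inter: "num_zeros G UNIV = degree G \<and>
      card (S \<inter> U) \<le> num_zeros G U \<and> num_zeros G U \<le> card (S \<inter> U) + 1"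
    if "upper_set U" for U
    using S G degG sign that by (rule interlacing_of_signs)
  show "num_zeros F UNIV = degree F"
    using inter[OF upper_set_UNIV] num_F[of UNIV] num_d deg_F by simp
  show "num_zeros f U \<le> num_zeros F U" "num_zeros F U \<le> num_zeros f U + 1" if "upper_set U"
    using inter[OF that] num_F[of U] num_f[of U] by simp_all
qed

section \<open>Local behaviour of F at a zero of f\<close>

lemma order_linear_power_mult:
  fixes q :: "real poly"
  assumes "poly q a \<noteq> 0"
  shows "order a ([:-a, 1:] ^ n * q) = n"
proof -
  have "q \<noteq> 0" using assms by auto
  then show ?thesis using assms by (subst order_mult) (auto simp: order_power_n_n order_0I)
qed

text \<open>By the product rule \<open>pderiv f\<close> loses one factor \<open>L\<close>, so
  \<open>F\<close> has at least \<open>m - 1\<close> of them. If \<open>v\<close> vanishes at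
  \<open>r\<close>, it supplies the lost factor.\<close>

lemma combination_at_root:
  fixes f u v :: "real poly"
  assumes f: "f \<noteq> 0" "poly f r = 0" and F: "F = u * f + v * pderiv f"
  defines "m \<equiv> order r f"
  obtains g H where "f = [:-r, 1:] ^ m * g" "poly g r \<noteq> 0"
    "F = [:-r, 1:] ^ (m - 1) * H" "poly H r = poly v r * (m * poly g r)"
    "poly v r = 0 \<Longrightarrow> \<exists>Q. F = [:-r, 1:] ^ m * Q \<and>
      poly Q r = poly g r * (poly u r + m * poly (pderiv v) r)"
proof -
  define L where "L = [:-r, 1:]"
  have L: "poly L r = 0" "pderiv L = 1" by (simp_all add: L_def pderiv_pCons one_pCons)
  obtain g where g: "f = L ^ m * g" "\<not> L dvd g"
    using order_decomp[OF f(1), of r] unfolding L_def m_def by blast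
  have gr: "poly g r \<noteq> 0" using g(2) by (simp add: L_def dvd_iff_poly_eq_0)
  define k where "k = m - 1"
  have m: "m = Suc k" using f by (simp add: m_def k_def order_root)
  define H where "H = u * L * g + v * (smult m g + L * pderiv g)"
  have "pderiv (L ^ m) = smult m (L ^ k)"
    unfolding m pderiv_power_Suc by (simp add: L)
  moreover have Lm: "L ^ m = L ^ k * L" by (simp only: m power_Suc2)
  ultimately have df: "pderiv f = L ^ k * (smult m g + L * pderiv g)"
    unfolding g(1) pderiv_mult by (simp add: algebra_simps)
  have FH: "F = L ^ (m - 1) * H"
    unfolding F df k_def[symmetric] H_def unfolding g(1) Lm by (simp add: algebra_simps)
  have Hr: "poly H r = poly v r * (m * poly g r)" by (simp add: H_def L)
  have "\<exists>Q. F = L ^ m * Q \<and> poly Q r = poly g r * (poly u r + m * poly (pderiv v) r)"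
    if v0: "poly v r = 0"
  proof -
    \<comment> \<open>The value of \<open>w\<close> at \<open>r\<close> is that of
      \<open>pderiv v\<close>, the source of the derivative in the criterion.\<close>
    obtain w where w: "v = L * w" using v0 unfolding L_def poly_eq_0_iff_dvd by (rule dvdE)
    have "H = L * (u * g + w * (smult m g + L * pderiv g))"
      unfolding H_def w by (simp add: algebra_simps)
    then have FL: "F = L ^ m * (u * g + w * (smult m g + L * pderiv g))"
      unfolding FH Lm k_def[symmetric] by (simp only: mult.assoc)
    have "poly (pderiv v) r = poly w r" by (simp add: w pderiv_mult L)
    then have "poly (u * g + w * (smult m g + L * pderiv g)) r =
        poly g r * (poly u r + m * poly (pderiv v) r)"
      by (simp add: L algebra_simps)
    with FL show ?thesis by (intro exI conjI)
  qed
  then show ?thesis using that[of g H] g(1) gr FH Hr unfolding L_def by simp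
qed

text \<open>The third case gives only a lower bound, since the local expansion does not exclude a
  higher order; interlacing supplies the upper bound in the theorem.\<close>

lemma order_combination:
  fixes f u v :: "real poly"
  assumes "f \<noteq> 0" "F \<noteq> 0" "poly f r = 0" "F = u * f + v * pderiv f"
  defines "m \<equiv> order r f"
  shows "poly v r \<noteq> 0 \<Longrightarrow> order r F = m - 1"
    and "poly v r = 0 \<Longrightarrow> poly u r + m * poly (pderiv v) r \<noteq> 0 \<Longrightarrow> order r F = m"
    and "poly v r = 0 \<Longrightarrow> poly u r + m * poly (pderiv v) r = 0 \<Longrightarrow> m + 1 \<le> order r F"
proof -
  obtain g H where g: "f = [:-r, 1:] ^ m * g" "poly g r \<noteq> 0"
    and H: "F = [:-r, 1:] ^ (m - 1) * H" "poly H r = poly v r * (m * poly g r)"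
    and Q: "poly v r = 0 \<Longrightarrow> \<exists>Q. F = [:-r, 1:] ^ m * Q \<and>
      poly Q r = poly g r * (poly u r + m * poly (pderiv v) r)"
    using combination_at_root[OF assms(1,3,4), folded m_def] by blast
  have m0: "m \<noteq> 0" using assms(1,3) by (simp add: m_def order_root)
  show "order r F = m - 1" if "poly v r \<noteq> 0"
    unfolding H(1) using that H(2) g(2) m0 by (intro order_linear_power_mult) simp
  show "order r F = m" if "poly v r = 0" "poly u r + m * poly (pderiv v) r \<noteq> 0"
    using Q[OF that(1)] that(2) g(2) order_linear_power_mult[of _ r m] by auto
  show "m + 1 \<le> order r F" if v0: "poly v r = 0" and \<kappa>0: "poly u r + m * poly (pderiv v) r = 0"
  proof -
    obtain Q where Q: "F = [:-r, 1:] ^ m * Q" "poly Q r = 0" using Q[OF v0] \<kappa>0 by auto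
    have "[:-r, 1:] ^ m * [:-r, 1:] dvd [:-r, 1:] ^ m * Q"
      using Q(2) by (intro mult_dvd_mono dvd_refl) (simp only: poly_eq_0_iff_dvd)
    then have "[:-r, 1:] ^ (m + 1) dvd F" unfolding Q(1) by (simp only: power_add power_one_right)
    then show ?thesis using assms(2) by (simp only: order_divides) simp
  qed
qed

text \<open>After division by the \<open>m\<close>-th power of the linear factor, the cofactors
  satisfy \<open>poly Q r = poly g r * \<kappa>\<close>. The sign of \<kappa> is thus the product of
  their signs, which the zeros above \<open>r\<close> determine.\<close>

lemma sgn_combination:
  fixes f u v :: "real poly"
  assumes f: "lead_coeff f > 0" and F: "lead_coeff F > 0"
    and r: "poly f r = 0" and eq: "F = u * f + v * pderiv f" and v: "poly v r = 0"
  defines "\<kappa> \<equiv> poly u r + order r f * poly (pderiv v) r"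
  assumes \<kappa>: "\<kappa> \<noteq> 0"
  shows "\<kappa> > 0 \<longleftrightarrow> even (num_zeros F {r<..} + num_zeros f {r<..})"
proof -
  define m where "m = order r f"
  have f0: "f \<noteq> 0" using f by auto
  obtain g where g: "f = [:-r, 1:] ^ m * g" "poly g r \<noteq> 0"
    and ex: "\<exists>Q. F = [:-r, 1:] ^ m * Q \<and> poly Q r = poly g r * \<kappa>"
    using combination_at_root[OF f0 r eq] v unfolding \<kappa>_def m_def by metis
  from ex obtain Q where FQ: "F = [:-r, 1:] ^ m * Q" and Q: "poly Q r = poly g r * \<kappa>" by blast
  \<comment> \<open>The removed power affects neither the leading coefficient nor the zeros strictly
    above \<open>r\<close>.\<close>
  have *: "sgn (poly q r) = (-1) ^ num_zeros p {r<..}"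
    if "p = [:-r, 1:] ^ m * q" "lead_coeff p > 0" "poly q r \<noteq> 0" for p q
  proof -
    have "lead_coeff q > 0" using that(2) unfolding that(1) lead_coeff_mult
      by (simp add: lead_coeff_power)
    moreover have "num_zeros p {r<..} = num_zeros q {r<..}"
      using that(3) unfolding that(1)
      by (subst num_zeros_mult) (auto simp: num_zeros_linear_power)
    ultimately show ?thesis using sgn_poly_eq_num_zeros[of q r] that(3) by simp
  qed
  have "sgn (poly Q r) * sgn (poly g r) = (-1) ^ (num_zeros F {r<..} + num_zeros f {r<..})"
    using *[OF FQ F] *[OF g(1) f g(2)] Q g(2) \<kappa> by (simp add: power_add)
  moreover have "sgn (poly Q r) * sgn (poly g r) = sgn \<kappa> * (sgn (poly g r) * sgn (poly g r))"
    by (simp only: Q sgn_mult mult_ac)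
  moreover have "sgn (poly g r) * sgn (poly g r) = 1"
    using g(2) by (simp add: sgn_real_def)
  ultimately show ?thesis using \<kappa>
    by (cases "even (num_zeros F {r<..} + num_zeros f {r<..})") (auto simp: sgn_if split: if_splits)
qed

section \<open>Multiplicities and extreme zeros: the theorem\<close>

lemma num_zeros_add_Compl: "num_zeros p U + num_zeros p (- U) = num_zeros p UNIV"
  by (simp only: num_zeros_def Compl_iff multiset_partition[symmetric] size_union[symmetric]) simp

lemma RZ_on_iff_num_zeros:
  "p \<noteq> 0 \<Longrightarrow> p \<in> RZ_on I \<longleftrightarrow> p \<in> RZ \<and> num_zeros p (- I) = 0"
  by (auto simp: RZ_on_def num_zeros_eq_0_iff)

theorem theorem2:
  fixes f F u v :: "real poly"
  assumes "standard_poly f" and "standard_poly F"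
    and "F = u * f + v * pderiv f"
    and "degree F = degree f \<or> degree F = degree f + 1"
    and "f \<in> RZ"
    and "\<And>r. poly f r = 0 \<Longrightarrow> poly v r \<le> 0"
  shows "F \<in> RZ \<and> f \<preceq> F \<and>
    (\<forall>r m. poly f r = 0 \<and> order r f = m \<longrightarrow>
       (poly v r \<noteq> 0 \<longrightarrow> order r F = m - 1) \<and>
       (poly v r = 0 \<and> poly u r + real m * poly (pderiv v) r \<noteq> 0 \<longrightarrow> order r F = m) \<and>
       (poly v r = 0 \<and> poly u r + real m * poly (pderiv v) r = 0 \<longrightarrow> order r F = m + 1)) \<and>
    (\<forall>r m. f \<in> RZ_on {..r} \<and> poly f r = 0 \<and> order r f = m \<longrightarrow>
       (F \<in> RZ_on {..r} \<longleftrightarrow>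
         poly v r = 0 \<and> poly u r + real m * poly (pderiv v) r \<ge> 0)) \<and>
    (\<forall>r m. f \<in> RZ_on {r..} \<and> poly f r = 0 \<and> order r f = m \<longrightarrow>
       (F \<in> RZ_on {r..} \<longleftrightarrow>
         degree F = degree f \<or>
         (poly v r = 0 \<and> poly u r + real m * poly (pderiv v) r \<le> 0)))"
proof -
  note F_eq = assms(3) and deg = assms(4)
  have lc: "lead_coeff f > 0" "lead_coeff F > 0"
    using assms(1,2) by (simp_all add: standard_poly_def)
  then have nz: "f \<noteq> 0" "F \<noteq> 0" by auto
  have rr_f: "num_zeros f UNIV = degree f" using assms(5) nz by (simp add: RZ_iff_num_zeros)
  note inter = interlacing_of_combination[OF lc F_eq deg rr_f assms(6)]
  have rr_F: "num_zeros F UNIV = degree F" by (rule inter(1))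
  then have F_RZ: "F \<in> RZ" using nz by (simp add: RZ_iff_num_zeros)
  have gt: "num_zeros f {r<..} \<le> num_zeros F {r<..}"
      "num_zeros F {r<..} \<le> num_zeros f {r<..} + 1" for r
    using inter(2,3)[OF _ upper_set_greaterThan] by blast+
  have ge: "num_zeros f {r<..} + order r f \<le> num_zeros F {r<..} + order r F"
      "num_zeros F {r<..} + order r F \<le> num_zeros f {r<..} + order r f + 1" for r
    using inter(2,3)[OF _ upper_set_atLeast, of r] nz by (simp_all add: num_zeros_atLeast)
  have sep: "f \<preceq> F"
    using assms(5) F_RZ nz gt deg by (intro separatesI) auto
  \<comment> \<open>The second fact makes the natural-number subtraction in the first exact.\<close>
  have less_zeros: "num_zeros p (- {r..}) = degree p - (num_zeros p {r<..} + order r p)"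
      "num_zeros p {r<..} + order r p \<le> degree p"
    if "p \<noteq> 0" "num_zeros p UNIV = degree p" for p r
    using num_zeros_add_Compl[of p "{r..}"] that by (simp_all add: num_zeros_atLeast)
  have mult: "(poly v r \<noteq> 0 \<longrightarrow> order r F = m - 1) \<and>
       (poly v r = 0 \<and> poly u r + real m * poly (pderiv v) r \<noteq> 0 \<longrightarrow> order r F = m) \<and>
       (poly v r = 0 \<and> poly u r + real m * poly (pderiv v) r = 0 \<longrightarrow> order r F = m + 1)"
    if r: "poly f r = 0" and m: "order r f = m" for r m
  proof -
    \<comment> \<open>At least as many zeros of \<open>F\<close> as of \<open>f\<close> lie above
      \<open>r\<close>, and at most one more lies at or above \<open>r\<close>.\<close>
    have "order r F \<le> m + 1" using ge(2)[of r] gt(1)[of r] m by simp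
    then show ?thesis
      using order_combination[OF nz r F_eq] m by (auto intro: antisym)
  qed
  \<comment> \<open>Decides whether the possible extra zero of \<open>F\<close> lies above
    \<open>r\<close>: parity settles the cases of nonzero criterion, and in the last case the order
    \<open>m + 1\<close> already uses up the extra zero.\<close>
  have position: "(poly v r \<noteq> 0 \<and> order r F = m - 1) \<or>
      (poly v r = 0 \<and> poly u r + real m * poly (pderiv v) r > 0 \<and> order r F = m \<and>
        num_zeros F {r<..} = num_zeros f {r<..}) \<or>
      (poly v r = 0 \<and> poly u r + real m * poly (pderiv v) r < 0 \<and> order r F = m \<and>
        num_zeros F {r<..} = num_zeros f {r<..} + 1) \<or>
      (poly v r = 0 \<and> poly u r + real m * poly (pderiv v) r = 0 \<and> order r F = m + 1 \<and>
        num_zeros F {r<..} = num_zeros f {r<..})"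
    if r: "poly f r = 0" and m: "order r f = m" for r m
  proof -
    consider (a) "poly v r \<noteq> 0"
      | (b) "poly v r = 0" "poly u r + real m * poly (pderiv v) r \<noteq> 0"
      | (c) "poly v r = 0" "poly u r + real m * poly (pderiv v) r = 0" by blast
    then show ?thesis
    proof cases
      case a
      then show ?thesis using mult[OF r m] by blast
    next
      case b
      have "num_zeros F {r<..} = num_zeros f {r<..} \<or>
          num_zeros F {r<..} = num_zeros f {r<..} + 1" using gt[of r] by linarith
      then show ?thesis
        using b mult[OF r m] sgn_combination[OF lc r F_eq b(1)] m by auto
    next
      case c
      then have "order r F = m + 1" using mult[OF r m] by blast
      then show ?thesis using c ge[of r] gt[of r] m by simp
    qed
  qed
  have m_pos: "m > 0" if "poly f r = 0" "order r f = m" for r m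
    using that nz by (auto simp: order_root)
  have max: "F \<in> RZ_on {..r} \<longleftrightarrow>
      poly v r = 0 \<and> poly u r + real m * poly (pderiv v) r \<ge> 0"
    if f: "f \<in> RZ_on {..r}" and r: "poly f r = 0" and m: "order r f = m" for r m
  proof -
    have "- {..r} = {r<..}" by auto
    then have "num_zeros f {r<..} = 0" "F \<in> RZ_on {..r} \<longleftrightarrow> num_zeros F {r<..} = 0"
      using f F_RZ nz by (simp_all add: RZ_on_iff_num_zeros)
    \<comment> \<open>If \<open>v\<close> does not vanish at \<open>r\<close>, the order drops to
      \<open>m - 1\<close>, and the count on the closed ray forces a zero of \<open>F\<close> above
      \<open>r\<close>.\<close>
    then show ?thesis using position[OF r m] ge[of r] m_pos[OF r m] m by auto
  qed
  have min: "F \<in> RZ_on {r..} \<longleftrightarrow>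
      degree F = degree f \<or> (poly v r = 0 \<and> poly u r + real m * poly (pderiv v) r \<le> 0)"
    if f: "f \<in> RZ_on {r..}" and r: "poly f r = 0" and m: "order r f = m" for r m
  proof -
    have "num_zeros f {r<..} + m = degree f"
      using f less_zeros[OF nz(1) rr_f, of r] nz m by (simp add: RZ_on_iff_num_zeros)
    moreover have "F \<in> RZ_on {r..} \<longleftrightarrow> num_zeros F {r<..} + order r F = degree F"
      using F_RZ less_zeros[OF nz(2) rr_F, of r] nz by (auto simp: RZ_on_iff_num_zeros)
    \<comment> \<open>The zeros of \<open>F\<close> at or above \<open>r\<close> number
      \<open>degree f\<close> if the criterion is positive or \<open>v\<close> does not vanish at
      \<open>r\<close>, and \<open>degree f + 1\<close> otherwise; this is compared with
      \<open>degree F\<close>.\<close>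
    ultimately show ?thesis
      using position[OF r m] ge[of r] gt[of r] m_pos[OF r m] m deg less_zeros(2)[OF nz(2) rr_F, of r]
      by auto
  qed
  show ?thesis using F_RZ sep mult max min by blast
qed

end
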